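(* Let $\Omega$ be a finite set and $\{\mathcal L_i\}_{i\in\Omega}$ a finite family of weakly connected simple closure spaces, $\mathcal L_i$ on $\Sigma_i$, and put $\mathbf\Sigma=\prod_i\Sigma_i$. Let $\mathcal L\in\mathsf S(\mathcal L_i,i\in\Omega)$ and let $u\in\mathbf{Cl}(\mathcal L,\mathcal L)$ be large, send atoms to atoms, and be an automorphism of $\mathcal L$. Then there is a bijection $f$ of $\Omega$ and, for each $i\in\Omega$, an arrow $v_i\in\mathbf{Cl}(\mathcal L_i,\mathcal L_{f(i)})$ sending atoms to atoms, such that $u(p)_{f(i)}=v_i(p_i)$ for all $p\in\mathbf\Sigma$ and $i\in\Omega$.
   Context: A simple closure space on a nonempty set $\Sigma$ is a set $\mathcal L\subseteq 2^\Sigma$, ordered by inclusion, closed under arbitrary intersections and containing $\Sigma$, $\emptyset$ and all singletons; it is a complete atomistic lattice with top $1=\Sigma$ whose atoms are the singletons, and $p\in\Sigma$ is identified with $\{p\}$. $\mathbf{Cl}$ is the category of simple closure spaces with maps preserving arbitrary joins (hence $0$). $2$ is the simple closure space isomorphic to the two-element lattice. A map sending atoms to atoms induces a map on the underlying sets, denoted by the same letter. For $\mathbf\Sigma=\prod_\alpha\Sigma_\alpha$: $\pi_\beta$ is the $\beta$-th coordinate map; $p[B,\beta]$ (for $p\in\mathbf\Sigma$, $B\subseteq\Sigma_\beta$) is the set of points obtained from $p$ by replacing its $\beta$-th entry by an element of $B$. $\mathsf S(\mathcal L_\alpha,\alpha\in\Omega)$ is the set of all simple closure spaces $\mathcal L$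 on $\mathbf\Sigma=\prod_\alpha\Sigma_\alpha$ such that (P2) $\bigcup_\alpha\pi_\alpha^{-1}(a_\alpha)\in\mathcal L$ for all $a\in\prod_\alpha\mathcal L_\alpha$; and (P3) for all $p\in\mathbf\Sigma$, $\beta\in\Omega$, $B\subseteq\Sigma_\beta$, $p[B,\beta]\in\mathcal L$ implies $B\in\mathcal L_\beta$. A simple closure space $\mathcal L$ on $\Sigma$ is weakly connected if $\mathcal L\ne2$ and there is a family $\{A^\gamma\subseteq\Sigma:\gamma\in\sigma\}$ such that: (i) $\Sigma=\bigcup_{\gamma\in\sigma}A^\gamma$ and $|A^\gamma|\ge2$ for all $\gamma\in\sigma$; (ii) for all $\gamma\in\sigma$ and all $p\ne q$ in $A^\gamma$, $p\vee q$ contains a third atom (not necessarily in $A^\gamma$); (iii) for all $p,q\in\Sigma$ there is a finite subset $\{\gamma_1,\dots,\gamma_n\}\subseteq\sigma$ such that $p\in A^{\gamma_1}$, $q\in A^{\gamma_n}$, and $|A^{\gamma_i}\cap A^{\gamma_{i+1}}|\ge2$ for all $1\le i\le n-1$. For $\mathcal L_\alpha\ne2$ and $\mathcal L\in\mathsf S(\mathcal L_\alpha,\alpha\in\Omega)$, a map $u\in\mathbf{Cl}(\mathcal L,\mathcal L)$ is large if for all $\beta\in\Omega$ and $p\in\mathbf\Sigma$: $u(p[\Sigma_\beta,\beta])$ is not an atom of $\mathcal L$, and $u(1)\not\subseteq\pi_\beta^{-1}(p_\beta)$. *)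

theory Defs
  imports "HOL-Library.FuncSet" "HOL.Hull"
begin

text \<open>A closure space on a carrier set \<open>S\<close> is given by the set \<open>L\<close> of its closed subsets. The empty
  intersection is read as \<open>S\<close>, hence the nonemptiness condition below.\<close>

definition simple_closure_space :: "'a set \<Rightarrow> 'a set set \<Rightarrow> bool" where
  "simple_closure_space S L \<longleftrightarrow>
     S \<noteq> {} \<and> L \<subseteq> Pow S \<and> S \<in> L \<and> {} \<in> L \<and> (\<forall>p\<in>S. {p} \<in> L) \<and>
     (\<forall>\<A>. \<A> \<subseteq> L \<longrightarrow> \<A> \<noteq> {} \<longrightarrow> \<Inter>\<A> \<in> L)"

definition join :: "'a set set \<Rightarrow> 'a set set \<Rightarrow> 'a set" where
  "join L \<A> = (\<lambda>X. X \<in> L) hull \<Union>\<A>"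

definition atom :: "'a set set \<Rightarrow> 'a set \<Rightarrow> bool" where
  "atom L a \<longleftrightarrow> a \<in> L \<and> a \<noteq> {} \<and> (\<forall>b\<in>L. b \<subseteq> a \<longrightarrow> b = {} \<or> b = a)"

lemma join_is_least_upper_bound:
  assumes "simple_closure_space S L" and "\<A> \<subseteq> L"
  shows "join L \<A> \<in> L"
    and "\<And>A. A \<in> \<A> \<Longrightarrow> A \<subseteq> join L \<A>"
    and "\<And>C. C \<in> L \<Longrightarrow> (\<And>A. A \<in> \<A> \<Longrightarrow> A \<subseteq> C) \<Longrightarrow> join L \<A> \<subseteq> C"
proof -
  let ?T = "{t. t \<in> L \<and> \<Union>\<A> \<subseteq> t}"
  have "S \<in> ?T" using assms unfolding simple_closure_space_def by blast
  then have "?T \<noteq> {}" by blast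
  moreover have "?T \<subseteq> L" by blast
  ultimately show "join L \<A> \<in> L"
    using assms(1) unfolding simple_closure_space_def join_def hull_def by blast
  show "\<And>A. A \<in> \<A> \<Longrightarrow> A \<subseteq> join L \<A>" unfolding join_def hull_def by blast
  show "\<And>C. C \<in> L \<Longrightarrow> (\<And>A. A \<in> \<A> \<Longrightarrow> A \<subseteq> C) \<Longrightarrow> join L \<A> \<subseteq> C"
    unfolding join_def hull_def by blast
qed

lemma atom_iff_singleton:
  assumes "simple_closure_space S L"
  shows "atom L a \<longleftrightarrow> (\<exists>p\<in>S. a = {p})"
proof
  assume a: "atom L a"
  then obtain p where p: "p \<in> a" "p \<in> S"
    using assms unfolding atom_def simple_closure_space_def by blast
  then have "{p} \<in> L" using assms unfolding simple_closure_space_def by blast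
  then have "a = {p}" using a p unfolding atom_def by blast
  then show "\<exists>p\<in>S. a = {p}" using p by blast
next
  assume "\<exists>p\<in>S. a = {p}"
  then show "atom L a" using assms unfolding simple_closure_space_def atom_def by blast
qed

text \<open>The order \<open>bool\<close> is the two-element lattice.\<close>

definition is_two :: "'a set set \<Rightarrow> bool" where
  "is_two L \<longleftrightarrow>
     (\<exists>h. bij_betw h L (UNIV :: bool set) \<and> (\<forall>A\<in>L. \<forall>B\<in>L. A \<subseteq> B \<longleftrightarrow> h A \<le> h B))"

text \<open>Arrows are only relevant through their values on \<open>L\<^sub>1\<close>; they are not required to be extensional.
  The case \<open>\<A> = {}\<close> says that \<open>0\<close> is preserved.\<close>

definition cl_arrow :: "'a set set \<Rightarrow> 'b set set \<Rightarrow> ('a set \<Rightarrow> 'b set) \<Rightarrow> bool" where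
  "cl_arrow L\<^sub>1 L\<^sub>2 u \<longleftrightarrow>
     u \<in> L\<^sub>1 \<rightarrow> L\<^sub>2 \<and> (\<forall>\<A>. \<A> \<subseteq> L\<^sub>1 \<longrightarrow> u (join L\<^sub>1 \<A>) = join L\<^sub>2 (u ` \<A>))"

definition cl_automorphism :: "'a set set \<Rightarrow> ('a set \<Rightarrow> 'a set) \<Rightarrow> bool" where
  "cl_automorphism L u \<longleftrightarrow>
     cl_arrow L L u \<and> (\<exists>w. cl_arrow L L w \<and> (\<forall>A\<in>L. w (u A) = A \<and> u (w A) = A))"

definition atoms_to_atoms :: "'a set set \<Rightarrow> 'b set set \<Rightarrow> ('a set \<Rightarrow> 'b set) \<Rightarrow> bool" where
  "atoms_to_atoms L\<^sub>1 L\<^sub>2 u \<longleftrightarrow> (\<forall>a. atom L\<^sub>1 a \<longrightarrow> atom L\<^sub>2 (u a))"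

text \<open>The map on points induced by a map sending atoms to atoms; the value is meaningful only if
  \<open>u {p}\<close> is a singleton.\<close>

definition point_map :: "('a set \<Rightarrow> 'b set) \<Rightarrow> 'a \<Rightarrow> 'b" where
  "point_map u p = the_elem (u {p})"

text \<open>\<open>|X| \<ge> 2\<close>, including infinite \<open>X\<close> (for which \<open>card X = 0\<close>).\<close>

definition two_points :: "'a set \<Rightarrow> bool" where
  "two_points X \<longleftrightarrow> (\<exists>x\<in>X. \<exists>y\<in>X. x \<noteq> y)"

text \<open>The conditions depend on the family \<open>A\<^sup>\<gamma>\<close> only through the set \<open>\<A>\<close> of its members; the chain
  \<open>A\<^sup>\<gamma>\<^sup>1, \<dots>, A\<^sup>\<gamma>\<^sup>n\<close> is a nonempty list of members, in which repetitions are harmless.\<close>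

definition weakly_connected :: "'a set \<Rightarrow> 'a set set \<Rightarrow> bool" where
  "weakly_connected S L \<longleftrightarrow>
     \<not> is_two L \<and>
     (\<exists>\<A>. \<A> \<subseteq> Pow S \<and>
        S = \<Union>\<A> \<and> (\<forall>A\<in>\<A>. two_points A) \<and>
        (\<forall>A\<in>\<A>. \<forall>p\<in>A. \<forall>q\<in>A. p \<noteq> q \<longrightarrow> (\<exists>r\<in>join L {{p}, {q}}. r \<noteq> p \<and> r \<noteq> q)) \<and>
        (\<forall>p\<in>S. \<forall>q\<in>S. \<exists>As. As \<noteq> [] \<and> set As \<subseteq> \<A> \<and> p \<in> hd As \<and> q \<in> last As \<and>
           successively (\<lambda>A B. two_points (A \<inter> B)) As))"

definition coord_preimage :: "'i set \<Rightarrow> ('i \<Rightarrow> 'a set) \<Rightarrow> 'i \<Rightarrow> 'a set \<Rightarrow> ('i \<Rightarrow> 'a) set" where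
  "coord_preimage \<Omega> \<Sigma> \<beta> B = {p \<in> (\<Pi>\<^sub>E i\<in>\<Omega>. \<Sigma> i). p \<beta> \<in> B}"

definition replace_coord :: "('i \<Rightarrow> 'a) \<Rightarrow> 'a set \<Rightarrow> 'i \<Rightarrow> ('i \<Rightarrow> 'a) set" where
  "replace_coord p B \<beta> = (\<lambda>b. p(\<beta> := b)) ` B"

definition product_spaces ::
    "'i set \<Rightarrow> ('i \<Rightarrow> 'a set) \<Rightarrow> ('i \<Rightarrow> 'a set set) \<Rightarrow> ('i \<Rightarrow> 'a) set set set" where
  "product_spaces \<Omega> \<Sigma> Ls = {L.
     simple_closure_space (\<Pi>\<^sub>E i\<in>\<Omega>. \<Sigma> i) L \<and>
     (\<forall>a \<in> (\<Pi>\<^sub>E i\<in>\<Omega>. Ls i). (\<Union>i\<in>\<Omega>. coord_preimage \<Omega> \<Sigma> i (a i)) \<in> L) \<and>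
     (\<forall>p \<in> (\<Pi>\<^sub>E i\<in>\<Omega>. \<Sigma> i). \<forall>\<beta>\<in>\<Omega>. \<forall>B. B \<subseteq> \<Sigma> \<beta> \<longrightarrow>
        replace_coord p B \<beta> \<in> L \<longrightarrow> B \<in> Ls \<beta>)}"

definition large ::
    "'i set \<Rightarrow> ('i \<Rightarrow> 'a set) \<Rightarrow> ('i \<Rightarrow> 'a) set set \<Rightarrow> (('i \<Rightarrow> 'a) set \<Rightarrow> ('i \<Rightarrow> 'a) set) \<Rightarrow> bool" where
  "large \<Omega> \<Sigma> L u \<longleftrightarrow>
     (\<forall>\<beta>\<in>\<Omega>. \<forall>p \<in> (\<Pi>\<^sub>E i\<in>\<Omega>. \<Sigma> i).
        \<not> atom L (u (replace_coord p (\<Sigma> \<beta>) \<beta>)) \<and>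
        \<not> u (\<Pi>\<^sub>E i\<in>\<Omega>. \<Sigma> i) \<subseteq> coord_preimage \<Omega> \<Sigma> \<beta> {p \<beta>})"

end

theory Submission
  imports Defs
begin

text \<open>
  The automorphism \<open>u\<close> is a bijection \<open>\<phi>\<close> of the points of the product under which images and
  preimages of closed sets are closed (\<open>automorphism_point_map\<close>), so it transports the joins
  \<open>p \<squnion> q\<close> of points. The proof turns this into a statement about the Hamming graph on
  \<open>\<Pi>\<^sub>E i\<in>\<Omega>. \<Sigma> i\<close>, in which two points are joined if they differ in one coordinate.

  By (P2) the join of two points that differ in at least two coordinates consists of these two
  points only (\<open>third_point_imp_near\<close>). By (P2) and (P3) a line, along which only the \<open>i\<close>-th
  coordinate varies, carries exactly the closed sets of the factor \<open>Ls i\<close>. Hence if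
  the join of \<open>x\<close> and \<open>y\<close> in \<open>Ls i\<close> has a third point, the images under \<open>\<phi>\<close> of the
  corresponding two points of a line differ in a single coordinate. The sets \<open>A\<^sup>\<gamma>\<close> of weak
  connectedness are therefore mapped to cliques of the Hamming graph. The points of a clique all
  differ in one common coordinate (\<open>near_family_single_direction\<close>), and this coordinate is
  determined by two points of the clique, so it is inherited along a chain of overlapping
  sets \<open>A\<^sup>\<gamma>\<close>. It follows that \<open>\<phi>\<close> preserves adjacency. The same argument applies to
  the inverse of \<open>\<phi>\<close>, and so \<open>\<phi>\<close> is an automorphism of the Hamming graph.

  Such an automorphism permutes the coordinate directions and then acts in each coordinate
  separately (\<open>near_automorphism_is_coordinatewise\<close>): lines go into lines, and parallel lines go
  into parallel lines because two points at distance two have exactly two common neighbours, so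
  that the image of a square is a square with the same pairs of opposite sides. This gives \<open>f\<close>
  and maps \<open>g i\<close> of the factors. Pulling a closed set of \<open>Ls (f i)\<close> back to the product, then
  by \<open>\<phi>\<close>, then to a line, shows that preimages of closed sets under \<open>g i\<close> are closed, which is
  what makes \<open>A \<mapsto>\<close> (closure of \<open>g i ` A\<close>) preserve joins
  (\<open>arrow_of_continuous_point_map\<close>).
\<close>

section \<open>Points at Hamming distance at most one\<close>

text \<open>
  Equality is included, so that pairs on a common line are described without a case distinction.
  The index \<open>j\<close> is not confined to \<open>\<Omega>\<close>, because points of the product agree outside
  \<open>\<Omega>\<close> anyway.
\<close>

definition near :: "('i \<Rightarrow> 'a) \<Rightarrow> ('i \<Rightarrow> 'a) \<Rightarrow> bool" where
  "near p q \<longleftrightarrow> (\<exists>j. \<forall>k. k \<noteq> j \<longrightarrow> p k = q k)"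

text \<open>
  The cliques of a Hamming graph lie on lines: if \<open>y\<close> and \<open>z\<close> differed from \<open>x\<close> in two
  different coordinates, they would differ from each other in both.
\<close>

lemma near_family_single_direction:
  assumes inj: "inj_on g S"
    and near: "\<And>x y. x \<in> S \<Longrightarrow> y \<in> S \<Longrightarrow> near (g x) (g y)"
  shows "\<exists>j. \<forall>x\<in>S. \<forall>y\<in>S. \<forall>k. k \<noteq> j \<longrightarrow> g x k = g y k"
proof (cases "two_points S")
  case False
  then show ?thesis unfolding two_points_def by metis
next
  case True
  then obtain x0 y0 where x0: "x0 \<in> S" and y0: "y0 \<in> S" and ne: "x0 \<noteq> y0"
    unfolding two_points_def by blast
  obtain j where j: "\<And>k. k \<noteq> j \<Longrightarrow> g x0 k = g y0 k"
    using near[OF x0 y0] unfolding near_def by blast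
  have gne: "g x0 j \<noteq> g y0 j"
  proof
    assume "g x0 j = g y0 j"
    then have "g x0 = g y0" using j by (metis ext)
    then show False using inj x0 y0 ne by (auto dest: inj_onD)
  qed
  have star: "g z k = g x0 k" if z: "z \<in> S" and k: "k \<noteq> j" for z k
  proof (rule ccontr)
    assume zk: "g z k \<noteq> g x0 k"
    obtain m where m: "\<And>l. l \<noteq> m \<Longrightarrow> g z l = g x0 l"
      using near[OF z x0] unfolding near_def by blast
    obtain n where n: "\<And>l. l \<noteq> n \<Longrightarrow> g z l = g y0 l"
      using near[OF z y0] unfolding near_def by blast
    have "m = k" using m zk by metis
    then have "g z j \<noteq> g y0 j" using m k gne by metis
    then have "n = j" using n by metis
    then show False using n[OF k[folded \<open>n = j\<close>]] j[OF k] zk k by metis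
  qed
  then show ?thesis by metis
qed

lemma fun_upd_in_PiE:
  "p \<in> (\<Pi>\<^sub>E i\<in>\<Omega>. \<Sigma> i) \<Longrightarrow> i \<in> \<Omega> \<Longrightarrow> x \<in> \<Sigma> i \<Longrightarrow> p(i := x) \<in> (\<Pi>\<^sub>E i\<in>\<Omega>. \<Sigma> i)"
  by (auto simp: PiE_iff extensional_def)

text \<open>
  Two points that differ only in a finite set \<open>J\<close> of coordinates are linked by changing one
  coordinate after the other. This is used with \<open>J = \<Omega>\<close>, for the direction of the images of
  lines, and with \<open>J = \<Omega> - {i}\<close>, for the dependence on the \<open>i\<close>-th coordinate alone.
\<close>

lemma eq_if_invariant_under_coordinate_changes:
  fixes h :: "('i \<Rightarrow> 'a) \<Rightarrow> 'c"
  assumes "finite J" and "J \<subseteq> \<Omega>"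
    and step: "\<And>p j x. p \<in> (\<Pi>\<^sub>E i\<in>\<Omega>. \<Sigma> i) \<Longrightarrow> j \<in> J \<Longrightarrow> x \<in> \<Sigma> j \<Longrightarrow> h (p(j := x)) = h p"
    and "p \<in> (\<Pi>\<^sub>E i\<in>\<Omega>. \<Sigma> i)" and "q \<in> (\<Pi>\<^sub>E i\<in>\<Omega>. \<Sigma> i)"
    and "\<And>k. k \<notin> J \<Longrightarrow> p k = q k"
  shows "h p = h q"
  using assms
proof (induction J arbitrary: p rule: finite_induct)
  case empty
  then have "p = q" by auto
  then show ?case by simp
next
  case (insert j J)
  have j: "j \<in> \<Omega>" and x: "q j \<in> \<Sigma> j" using insert.prems by auto
  have P: "p(j := q j) \<in> (\<Pi>\<^sub>E i\<in>\<Omega>. \<Sigma> i)"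
    using fun_upd_in_PiE[OF insert.prems(3) j x] .
  have "h (p(j := q j)) = h q"
    using insert.prems insert.hyps P by (intro insert.IH) auto
  moreover have "h (p(j := q j)) = h p" using insert.prems x by blast
  ultimately show ?case by simp
qed

section \<open>Hamming isometries act coordinatewise\<close>

text \<open>
  The classical description of the automorphisms of a Hamming graph. A line is a clique, so its
  image varies in one coordinate, called \<open>d p i\<close> for the line through \<open>p\<close> in direction \<open>i\<close>.
  The main point is that \<open>d p i\<close> does not depend on \<open>p\<close>.
\<close>

lemma near_automorphism_is_coordinatewise:
  fixes \<Omega> :: "'i set" and \<Sigma> :: "'i \<Rightarrow> 'a set" and \<phi> :: "('i \<Rightarrow> 'a) \<Rightarrow> ('i \<Rightarrow> 'a)"
  defines "P \<equiv> (\<Pi>\<^sub>E i\<in>\<Omega>. \<Sigma> i)"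
  assumes fin: "finite \<Omega>"
    and two: "\<And>i. i \<in> \<Omega> \<Longrightarrow> two_points (\<Sigma> i)"
    and maps: "\<And>p. p \<in> P \<Longrightarrow> \<phi> p \<in> P"
    and inj: "inj_on \<phi> P"
    and near: "\<And>p q. p \<in> P \<Longrightarrow> q \<in> P \<Longrightarrow> near (\<phi> p) (\<phi> q) \<longleftrightarrow> near p q"
  shows "\<exists>f g. bij_betw f \<Omega> \<Omega> \<and> (\<forall>p\<in>P. \<forall>i\<in>\<Omega>. \<phi> p (f i) = g i (p i))"
proof -
  have upd: "p(i := x) \<in> P" if "p \<in> P" "i \<in> \<Omega>" "x \<in> \<Sigma> i" for p i x
    using that unfolding P_def by (rule fun_upd_in_PiE)
  have mem: "p i \<in> \<Sigma> i" if "p \<in> P" "i \<in> \<Omega>" for p i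
    using that unfolding P_def by auto
  have ext: "i \<in> \<Omega>" if "p \<in> P" "q \<in> P" "p i \<noteq> q i" for p q i
    using that unfolding P_def by (metis PiE_arb)
  have inj': "\<phi> p \<noteq> \<phi> q" if "p \<in> P" "q \<in> P" "p i \<noteq> q i" for p q i
    using inj that by (auto dest: inj_onD)
  have "\<exists>j. \<forall>x\<in>\<Sigma> i. \<forall>y\<in>\<Sigma> i. \<forall>k. k \<noteq> j \<longrightarrow> \<phi> (p(i := x)) k = \<phi> (p(i := y)) k"
    if p: "p \<in> P" and i: "i \<in> \<Omega>" for p i
  proof (rule near_family_single_direction)
    show "inj_on (\<lambda>x. \<phi> (p(i := x))) (\<Sigma> i)"
    proof (rule inj_onI)
      fix x y assume "x \<in> \<Sigma> i" "y \<in> \<Sigma> i" "\<phi> (p(i := x)) = \<phi> (p(i := y))"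
      then have "p(i := x) = p(i := y)" using inj upd p i by (auto dest: inj_onD)
      then show "x = y" by (metis fun_upd_same)
    qed
    fix x y assume "x \<in> \<Sigma> i" "y \<in> \<Sigma> i"
    moreover have "near (p(i := x)) (p(i := y))" unfolding near_def by auto
    ultimately show "near (\<phi> (p(i := x))) (\<phi> (p(i := y)))" using near upd p i by blast
  qed
  then obtain d where d: "\<And>p i x y k. p \<in> P \<Longrightarrow> i \<in> \<Omega> \<Longrightarrow> x \<in> \<Sigma> i \<Longrightarrow> y \<in> \<Sigma> i \<Longrightarrow> k \<noteq> d p i
      \<Longrightarrow> \<phi> (p(i := x)) k = \<phi> (p(i := y)) k"
    by metis
  have off: "\<phi> (p(i := x)) k = \<phi> p k"
    if "p \<in> P" "i \<in> \<Omega>" "x \<in> \<Sigma> i" "k \<noteq> d p i" for p i x k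
    using d[OF that(1,2,3) mem[OF that(1,2)] that(4)] by simp
  have at: "\<phi> (p(i := x)) (d p i) \<noteq> \<phi> p (d p i)"
    if "p \<in> P" "i \<in> \<Omega>" "x \<in> \<Sigma> i" "x \<noteq> p i" for p i x
  proof
    assume "\<phi> (p(i := x)) (d p i) = \<phi> p (d p i)"
    then have "\<phi> (p(i := x)) = \<phi> p" using off[OF that(1,2,3)] by (metis HOL.ext)
    moreover have "\<phi> (p(i := x)) \<noteq> \<phi> p"
      using that upd by (intro inj'[of _ _ i]) auto
    ultimately show False by simp
  qed
  have other: "\<exists>x\<in>\<Sigma> i. x \<noteq> c" if "i \<in> \<Omega>" for i c
    using two[OF that] unfolding two_points_def by metis

  \<comment> \<open>Otherwise \<open>p(i := x)\<close> and \<open>p(j := y)\<close>, at distance two, would have images on a common line.\<close>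
  have d_distinct: "d p i \<noteq> d p j" if p: "p \<in> P" and i: "i \<in> \<Omega>" and j: "j \<in> \<Omega>" and ij: "i \<noteq> j" for p i j
  proof
    assume eq: "d p i = d p j"
    obtain x where x: "x \<in> \<Sigma> i" "x \<noteq> p i" using other[OF i] by blast
    obtain y where y: "y \<in> \<Sigma> j" "y \<noteq> p j" using other[OF j] by blast
    have "near (\<phi> (p(i := x))) (\<phi> (p(j := y)))"
      unfolding near_def using off[OF p i x(1)] off[OF p j y(1)] eq by metis
    then have "near (p(i := x)) (p(j := y))" using near upd p i j x y by blast
    then show False unfolding near_def using x y ij by (metis fun_upd_other fun_upd_same)
  qed

  \<comment> \<open>The lines through \<open>p\<close> and \<open>p(j := y)\<close> in direction \<open>i\<close> are equal or opposite sides of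
    squares. In a square \<open>p, b, e, c\<close> the image of \<open>e\<close> is a common neighbour of those of \<open>b\<close>
    and \<open>c\<close>, which leaves only the image of \<open>p\<close>, excluded by injectivity, and the
    fourth corner of the square of images.\<close>
  have d_step: "d (p(j := y)) i = d p i"
    if p: "p \<in> P" and j: "j \<in> \<Omega>" and y: "y \<in> \<Sigma> j" and i: "i \<in> \<Omega>" for p i j y
  proof (cases "y = p j \<or> i = j")
    case True
    show ?thesis
    proof (cases "y = p j")
      case True
      then show ?thesis by simp
    next
      case False
      then have ij: "i = j" using True by blast
      \<comment> \<open>The two lines coincide: \<open>p\<close> is recovered from \<open>p(j := y)\<close> by restoring the entry \<open>p i\<close>.\<close>
      then have "\<phi> (p(j := y)) (d p i) \<noteq> \<phi> p (d p i)" using at[OF p i] y False by blast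
      then have "\<phi> ((p(j := y))(i := p i)) (d p i) \<noteq> \<phi> (p(j := y)) (d p i)" using ij by simp
      then show ?thesis using off[OF upd[OF p j y] i mem[OF p i]] by metis
    qed
  next
    case False
    obtain x where x: "x \<in> \<Sigma> i" "x \<noteq> p i" using other[OF i] by blast
    let ?m = "d p i" and ?n = "d p j"
    let ?b = "p(i := x)" and ?c = "p(j := y)" and ?e = "p(j := y, i := x)"
    have mn: "?m \<noteq> ?n" using d_distinct p i j False by blast
    have e: "?e = ?b(j := y)" using fun_upd_twist[of j i p y x] False by metis
    have b: "?b \<in> P" and c: "?c \<in> P" using upd p i j x y by auto
    have ce: "\<phi> ?e k = \<phi> ?c k" if "k \<noteq> d ?c i" for k
      using off[OF c i x(1) that] .
    have be: "\<phi> ?e k = \<phi> ?b k" if "k \<noteq> d ?b j" for k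
      unfolding e using off[OF b j y that] .
    have bm: "\<phi> ?b ?m \<noteq> \<phi> p ?m" using at[OF p i] x by blast
    have cn: "\<phi> ?c ?n \<noteq> \<phi> p ?n" using at[OF p j] y False by blast
    have cm: "\<phi> ?c ?m = \<phi> p ?m" using off[OF p j y mn] .
    have bn: "\<phi> ?b ?n = \<phi> p ?n" using off[OF p i x(1)] mn by metis
    show ?thesis
    proof (rule ccontr)
      assume ne: "d ?c i \<noteq> ?m"
      then have "\<phi> ?e ?m \<noteq> \<phi> ?b ?m" using ce bm cm by metis
      \<comment> \<open>If the sides were not parallel, the image of \<open>e\<close> would return to that of \<open>p\<close>.\<close>
      then have bj: "d ?b j = ?m" using be by metis
      then have "\<phi> ?e ?n = \<phi> p ?n" using be bn mn by metis
      moreover from this have "d ?c i = ?n" using ce cn by metis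
      moreover have "\<phi> ?c k = \<phi> p k" if "k \<noteq> ?n" for k using off[OF p j y that] .
      ultimately have "\<phi> ?e = \<phi> p" using ce by (metis HOL.ext)
      moreover have "\<phi> ?e \<noteq> \<phi> p" using p c upd i x by (intro inj'[of _ _ i]) auto
      ultimately show False by simp
    qed
  qed

  show ?thesis
  proof (cases "P = {}")
    case True
    then show ?thesis by (intro exI[of _ id]) auto
  next
    case False
    then obtain base where base: "base \<in> P" by blast
    define f where "f = d base"
    have df: "d p i = f i" if "p \<in> P" "i \<in> \<Omega>" for p i
      unfolding f_def
    proof (rule eq_if_invariant_under_coordinate_changes[of \<Omega> \<Omega> \<Sigma> "\<lambda>p. d p i" p base])
      show "p k = base k" if "k \<notin> \<Omega>" for k using ext[OF \<open>p \<in> P\<close> base, of k] that by blast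
    qed (use fin that base d_step in \<open>auto simp: P_def\<close>)
    have f_mem: "f i \<in> \<Omega>" if i: "i \<in> \<Omega>" for i
    proof -
      obtain x where x: "x \<in> \<Sigma> i" "x \<noteq> base i" using other[OF i] by blast
      show ?thesis
        using ext[OF maps[OF upd[OF base i x(1)]] maps[OF base] at[OF base i x]] unfolding f_def .
    qed
    have f_inj: "inj_on f \<Omega>" using d_distinct[OF base] unfolding f_def inj_on_def by blast
    have "f ` \<Omega> = \<Omega>" using fin f_mem f_inj by (intro endo_inj_surj) auto
    then have bij: "bij_betw f \<Omega> \<Omega>" using f_inj unfolding bij_betw_def by blast
    define g where "g i x = \<phi> (base(i := x)) (f i)" for i x
    have "\<phi> p (f i) = g i (p i)" if p: "p \<in> P" and i: "i \<in> \<Omega>" for p i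
      unfolding g_def
    proof (rule eq_if_invariant_under_coordinate_changes
        [of "\<Omega> - {i}" \<Omega> \<Sigma> "\<lambda>p. \<phi> p (f i)" p "base(i := p i)"])
      fix q j x assume q: "q \<in> (\<Pi>\<^sub>E i\<in>\<Omega>. \<Sigma> i)" and j: "j \<in> \<Omega> - {i}" and x: "x \<in> \<Sigma> j"
      have qP: "q \<in> P" using q unfolding P_def .
      have "f i \<noteq> d q j" using df[OF qP] j i f_inj by (auto dest: inj_onD)
      then show "\<phi> (q(j := x)) (f i) = \<phi> q (f i)" using off qP j x by blast
    next
      fix k assume "k \<notin> \<Omega> - {i}"
      then show "p k = (base(i := p i)) k" using ext[OF p base, of k] by auto
    qed (use fin p upd[OF base i mem[OF p i]] in \<open>auto simp: P_def\<close>)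
    then show ?thesis using bij by blast
  qed
qed

section \<open>Closures and maps of simple closure spaces\<close>

lemma mem_join_iff: "r \<in> join L \<A> \<longleftrightarrow> (\<forall>C\<in>L. \<Union>\<A> \<subseteq> C \<longrightarrow> r \<in> C)"
  unfolding join_def hull_def by blast

lemma subset_join: "\<Union>\<A> \<subseteq> join L \<A>"
  unfolding subset_iff mem_join_iff by blast

lemma join_closed:
  assumes "simple_closure_space S L" and "\<Union>\<A> \<subseteq> S"
  shows "join L \<A> \<in> L"
proof -
  let ?T = "{t. t \<in> L \<and> \<Union>\<A> \<subseteq> t}"
  have "S \<in> ?T" using assms unfolding simple_closure_space_def by blast
  then have "?T \<noteq> {}" by blast
  moreover have "?T \<subseteq> L" by blast
  ultimately show ?thesis
    using assms(1) unfolding simple_closure_space_def join_def hull_def by blast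
qed

lemma join_subset_carrier:
  assumes "simple_closure_space S L" and "\<Union>\<A> \<subseteq> S"
  shows "join L \<A> \<subseteq> S"
  using join_closed[OF assms] assms(1) unfolding simple_closure_space_def by blast

text \<open>
  Join preservation is continuity: a closed set contains \<open>g ` A\<close> iff its preimage contains
  \<open>A\<close>, and being closed this preimage then contains the closure of \<open>A\<close> as well. Taking the
  closure of \<open>g ` A\<close> as value makes the values closed even if \<open>g\<close> does not map closed sets to
  closed sets.
\<close>

lemma arrow_of_continuous_point_map:
  assumes S: "simple_closure_space S L" and S': "simple_closure_space S' L'"
    and g: "g \<in> S \<rightarrow> S'"
    and cont: "\<And>C. C \<in> L' \<Longrightarrow> {x \<in> S. g x \<in> C} \<in> L"
  defines "v \<equiv> \<lambda>A. join L' {g ` A}"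
  shows "cl_arrow L L' v" and "atoms_to_atoms L L' v" and "x \<in> S \<Longrightarrow> point_map v x = g x"
proof -
  have sub: "A \<subseteq> S" if "A \<in> L" for A using S that unfolding simple_closure_space_def by blast
  have closed: "v A \<in> L'" if "A \<in> L" for A
    unfolding v_def by (rule join_closed[OF S']) (use g sub[OF that] in auto)
  show "cl_arrow L L' v" unfolding cl_arrow_def
  proof (intro conjI allI impI)
    show "v \<in> L \<rightarrow> L'" using closed by blast
    fix \<A> assume A: "\<A> \<subseteq> L"
    have AS: "\<Union>\<A> \<subseteq> S" using A sub by blast
    show "v (join L \<A>) = join L' (v ` \<A>)"
    proof
      have "g y \<in> C" if y: "y \<in> join L \<A>" and C: "C \<in> L'" "\<Union>(v ` \<A>) \<subseteq> C" for y C
      proof -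
        have "g z \<in> C" if "z \<in> \<Union>\<A>" for z
          using that C(2) subset_join[of "{g ` _}" L'] unfolding v_def by blast
        then have "\<Union>\<A> \<subseteq> {x \<in> S. g x \<in> C}" using AS by blast
        then show ?thesis using y cont[OF C(1)] by (auto simp: mem_join_iff)
      qed
      then show "v (join L \<A>) \<subseteq> join L' (v ` \<A>)"
        unfolding v_def by (subst subset_iff, subst (1 2) mem_join_iff) (auto simp: v_def)
    next
      have "v A \<subseteq> v (join L \<A>)" if "A \<in> \<A>" for A
      proof -
        have "A \<subseteq> join L \<A>" using that subset_join[of \<A> L] by blast
        then have "\<Union>{g ` A} \<subseteq> \<Union>{g ` join L \<A>}" by auto
        then show ?thesis unfolding v_def subset_iff mem_join_iff by meson
      qed
      moreover have "v (join L \<A>) \<in> L'" using closed join_closed[OF S AS] by blast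
      ultimately show "join L' (v ` \<A>) \<subseteq> v (join L \<A>)"
        by (metis UN_least mem_join_iff subsetI)
    qed
  qed
  have single: "v {x} = {g x}" if "x \<in> S" for x
  proof
    have "{g x} \<in> L'" using S' g that unfolding simple_closure_space_def by blast
    then show "v {x} \<subseteq> {g x}" unfolding v_def by (auto simp: mem_join_iff)
    show "{g x} \<subseteq> v {x}" unfolding v_def by (auto simp: mem_join_iff)
  qed
  show "atoms_to_atoms L L' v"
    unfolding atoms_to_atoms_def atom_iff_singleton[OF S] atom_iff_singleton[OF S']
    using single g by fastforce
  show "point_map v x = g x" if "x \<in> S" using single[OF that] unfolding point_map_def by simp
qed

text \<open>
  Both \<open>u\<close> and its inverse preserve inclusions, hence \<open>\<phi> p \<in> u A\<close> iff \<open>p \<in> A\<close>. So on closed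
  sets \<open>u\<close> is the image and its inverse the preimage under the point map.
\<close>

lemma automorphism_point_map:
  assumes S: "simple_closure_space S L"
    and ata: "atoms_to_atoms L L u" and aut: "cl_automorphism L u"
  defines "\<phi> \<equiv> point_map u"
  shows "bij_betw \<phi> S S"
    and "C \<in> L \<Longrightarrow> \<phi> ` C \<in> L"
    and "C \<in> L \<Longrightarrow> {p \<in> S. \<phi> p \<in> C} \<in> L"
proof -
  obtain w where u: "cl_arrow L L u" and w: "cl_arrow L L w"
    and inv: "\<forall>A\<in>L. w (u A) = A \<and> u (w A) = A"
    using aut unfolding cl_automorphism_def by auto
  have wu: "w (u A) = A" and uw: "u (w A) = A" if "A \<in> L" for A using inv that by auto
  have sing: "{p} \<in> L" if "p \<in> S" for p using S that unfolding simple_closure_space_def by blast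
  have sub: "A \<subseteq> S" if "A \<in> L" for A using S that unfolding simple_closure_space_def by blast
  have empty: "{} \<in> L" using S unfolding simple_closure_space_def by blast
  have mono: "a A \<subseteq> a B" if a: "cl_arrow L L a" and AB: "A \<in> L" "B \<in> L" "A \<subseteq> B" for a A B
  proof -
    have "join L {A, B} = B"
    proof
      show "join L {A, B} \<subseteq> B" using AB by (auto simp: mem_join_iff)
      show "B \<subseteq> join L {A, B}" using subset_join[of "{A, B}" L] by auto
    qed
    then have "a B = join L (a ` {A, B})"
      using a AB unfolding cl_arrow_def by (metis empty_subsetI insert_subset)
    then show ?thesis using subset_join[of "a ` {A, B}" L] by auto
  qed
  have uL: "u A \<in> L" and wL: "w A \<in> L" if "A \<in> L" for A
    using u w that unfolding cl_arrow_def by auto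
  have \<phi>: "u {p} = {\<phi> p}" and \<phi>S: "\<phi> p \<in> S" if "p \<in> S" for p
  proof -
    have "atom L {p}" using that atom_iff_singleton[OF S] by auto
    then have "atom L (u {p})" using ata unfolding atoms_to_atoms_def by auto
    then obtain q where "q \<in> S" "u {p} = {q}" using atom_iff_singleton[OF S] by auto
    then show "u {p} = {\<phi> p}" "\<phi> p \<in> S" unfolding \<phi>_def point_map_def by auto
  qed
  have iff: "\<phi> p \<in> u A \<longleftrightarrow> p \<in> A" if "p \<in> S" "A \<in> L" for p A
  proof
    assume "p \<in> A"
    then show "\<phi> p \<in> u A" using mono[OF u sing[OF that(1)] that(2)] \<phi>[OF that(1)] by auto
  next
    assume "\<phi> p \<in> u A"
    then have "u {p} \<subseteq> u A" using \<phi>[OF that(1)] by auto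
    then have "w (u {p}) \<subseteq> w (u A)" using mono w uL sing that by blast
    then show "p \<in> A" using wu sing that by auto
  qed
  have "inj_on \<phi> S"
  proof (rule inj_onI)
    fix p q assume "p \<in> S" "q \<in> S" "\<phi> p = \<phi> q"
    then have "{p} = {q}" using \<phi> wu sing by metis
    then show "p = q" by simp
  qed
  moreover have surj: "\<exists>p\<in>S. \<phi> p = q" if q: "q \<in> S" for q
  proof -
    have "u {} = {}"
      using mono[OF u empty wL[OF empty]] uw[OF empty] by auto
    then have "w {q} \<noteq> {}" using uw[OF sing[OF q]] by auto
    then obtain p where p: "p \<in> w {q}" by blast
    then have "p \<in> S" using sub wL sing q by blast
    moreover from this have "\<phi> p \<in> u (w {q})" using iff wL sing q p by blast
    ultimately show ?thesis using uw[OF sing[OF q]] by auto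
  qed
  ultimately show "bij_betw \<phi> S S" using \<phi>S unfolding bij_betw_def by blast
  show "\<phi> ` C \<in> L" if C: "C \<in> L"
  proof -
    have "\<phi> ` C = u C"
    proof
      show "\<phi> ` C \<subseteq> u C" using iff C sub by blast
      show "u C \<subseteq> \<phi> ` C"
      proof
        fix q assume q: "q \<in> u C"
        then obtain p where "p \<in> S" "\<phi> p = q" using surj sub uL C by blast
        then show "q \<in> \<phi> ` C" using q iff C by blast
      qed
    qed
    then show ?thesis using uL C by simp
  qed
  show "{p \<in> S. \<phi> p \<in> C} \<in> L" if C: "C \<in> L"
  proof -
    have "{p \<in> S. \<phi> p \<in> C} = w C"
      using iff[OF _ wL[OF C]] uw[OF C] sub[OF wL[OF C]] by auto
    then show ?thesis using wL C by simp
  qed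
qed

section \<open>Lines and joins in a product space\<close>

text \<open>Property (P2), freed from the restriction of the family \<open>a\<close> to extensional functions.\<close>

lemma coord_union_closed:
  assumes "L \<in> product_spaces \<Omega> \<Sigma> Ls" and "\<And>i. i \<in> \<Omega> \<Longrightarrow> a i \<in> Ls i"
  shows "{p \<in> (\<Pi>\<^sub>E i\<in>\<Omega>. \<Sigma> i). \<exists>i\<in>\<Omega>. p i \<in> a i} \<in> L"
proof -
  have "restrict a \<Omega> \<in> (\<Pi>\<^sub>E i\<in>\<Omega>. Ls i)" using assms(2) by auto
  then have "(\<Union>i\<in>\<Omega>. coord_preimage \<Omega> \<Sigma> i (restrict a \<Omega> i)) \<in> L"
    using assms(1) unfolding product_spaces_def by blast
  moreover have "(\<Union>i\<in>\<Omega>. coord_preimage \<Omega> \<Sigma> i (restrict a \<Omega> i))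
      = {p \<in> (\<Pi>\<^sub>E i\<in>\<Omega>. \<Sigma> i). \<exists>i\<in>\<Omega>. p i \<in> a i}"
    unfolding coord_preimage_def by auto
  ultimately show ?thesis by simp
qed

lemma coord_preimage_closed:
  assumes "L \<in> product_spaces \<Omega> \<Sigma> Ls" and "\<And>i. i \<in> \<Omega> \<Longrightarrow> simple_closure_space (\<Sigma> i) (Ls i)"
    and "i \<in> \<Omega>" and "B \<in> Ls i"
  shows "coord_preimage \<Omega> \<Sigma> i B \<in> L"
proof -
  let ?a = "\<lambda>j. if j = i then B else {}"
  have "?a j \<in> Ls j" if "j \<in> \<Omega>" for j
    using assms(2)[OF that] assms(4) unfolding simple_closure_space_def by auto
  from coord_union_closed[OF assms(1) this]
  have "{p \<in> (\<Pi>\<^sub>E i\<in>\<Omega>. \<Sigma> i). \<exists>j\<in>\<Omega>. p j \<in> ?a j} \<in> L" by blast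
  moreover have "{p \<in> (\<Pi>\<^sub>E i\<in>\<Omega>. \<Sigma> i). \<exists>j\<in>\<Omega>. p j \<in> ?a j} = coord_preimage \<Omega> \<Sigma> i B"
    unfolding coord_preimage_def using assms(3) by (auto split: if_splits)
  ultimately show ?thesis by simp
qed

text \<open>
  For \<open>k \<noteq> l\<close> the set of all \<open>r\<close> with \<open>r k = p k\<close> or \<open>r l = q l\<close> is closed by (P2) and
  contains \<open>p\<close> and \<open>q\<close>. If \<open>p\<close> and \<open>q\<close> differ in two coordinates, these conditions for all
  \<open>k\<close>, \<open>l\<close> force a point of the join to agree with \<open>p\<close> everywhere or with \<open>q\<close> everywhere.
\<close>

lemma third_point_imp_near:
  assumes L: "L \<in> product_spaces \<Omega> \<Sigma> Ls"
    and S: "\<And>i. i \<in> \<Omega> \<Longrightarrow> simple_closure_space (\<Sigma> i) (Ls i)"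
    and p: "p \<in> (\<Pi>\<^sub>E i\<in>\<Omega>. \<Sigma> i)" and q: "q \<in> (\<Pi>\<^sub>E i\<in>\<Omega>. \<Sigma> i)"
    and r: "r \<in> join L {{p}, {q}}" "r \<noteq> p" "r \<noteq> q"
  shows "near p q"
proof (rule ccontr)
  assume far: "\<not> near p q"
  let ?P = "\<Pi>\<^sub>E i\<in>\<Omega>. \<Sigma> i"
  have "simple_closure_space ?P L" using L unfolding product_spaces_def by blast
  then have rP: "r \<in> ?P" using join_subset_carrier[of ?P L "{{p}, {q}}"] r(1) p q by auto
  have out: "p k = r k \<and> q k = r k" if "k \<notin> \<Omega>" for k
    using p q rP that by (metis PiE_arb)
  have hit: "r k = p k \<or> r l = q l" if k: "k \<in> \<Omega>" and l: "l \<in> \<Omega>" and kl: "k \<noteq> l \<or> p k = q k" for k l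
  proof -
    \<comment> \<open>Points are closed, but pairs need not be. If \<open>k = l\<close>, the union is still a single point,
      because \<open>p k = q k\<close> in that case.\<close>
    let ?a = "\<lambda>m. (if m = k then {p k} else {}) \<union> (if m = l then {q l} else {})"
    have "?a m \<in> Ls m" if m: "m \<in> \<Omega>" for m
      using S[OF m] PiE_mem[OF p m] PiE_mem[OF q m] kl unfolding simple_closure_space_def by auto
    from coord_union_closed[OF L this]
    have "{x \<in> ?P. \<exists>m\<in>\<Omega>. x m \<in> ?a m} \<in> L" by blast
    moreover have "\<Union>{{p}, {q}} \<subseteq> {x \<in> ?P. \<exists>m\<in>\<Omega>. x m \<in> ?a m}" using p q k l by auto
    ultimately have "r \<in> {x \<in> ?P. \<exists>m\<in>\<Omega>. x m \<in> ?a m}" using r(1) unfolding mem_join_iff by blast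
    then show ?thesis by (auto split: if_splits)
  qed
  have same: "r k = p k" if "p k = q k" for k
    using hit[of k k] out[of k] that by (cases "k \<in> \<Omega>") auto
  obtain i where i: "p i \<noteq> q i" using far unfolding near_def by blast
  obtain j where j: "j \<noteq> i" "p j \<noteq> q j" using far unfolding near_def by blast
  have \<Omega>: "k \<in> \<Omega>" if "p k \<noteq> q k" for k using out that by metis
  show False
  proof (cases "r i = p i")
    case True
    have "r k = p k" for k
    proof (cases "k = i \<or> p k = q k")
      case True
      then show ?thesis using same \<open>r i = p i\<close> by blast
    next
      case False
      then show ?thesis using hit[of k i] \<Omega> i True by auto
    qed
    then show False using r(2) by auto
  next
    case False
    have off: "r k = q k" if "k \<noteq> i" for k
      using hit[of i k] same[of k] \<Omega> i False that by metis
    then have "r j \<noteq> p j" using j by metis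
    then have "r i = q i" using hit[of j i] \<Omega> i j by auto
    then have "r = q" using off by (metis ext)
    then show False using r(3) by simp
  qed
qed

text \<open>
  By (P2) the line through \<open>p\<close> in direction \<open>i\<close> is an intersection of closed sets
  \<open>\<pi>\<^sub>k\<^sup>-\<^sup>1(p\<^sub>k)\<close>. Its intersection with \<open>C\<close> has the form \<open>p[B,i]\<close>, to which (P3) applies.
\<close>

lemma slice_closed:
  assumes L: "L \<in> product_spaces \<Omega> \<Sigma> Ls"
    and S: "\<And>i. i \<in> \<Omega> \<Longrightarrow> simple_closure_space (\<Sigma> i) (Ls i)"
    and p: "p \<in> (\<Pi>\<^sub>E i\<in>\<Omega>. \<Sigma> i)" and i: "i \<in> \<Omega>" and C: "C \<in> L"
  shows "{b \<in> \<Sigma> i. p(i := b) \<in> C} \<in> Ls i"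
proof -
  let ?P = "\<Pi>\<^sub>E i\<in>\<Omega>. \<Sigma> i" and ?B = "{b \<in> \<Sigma> i. p(i := b) \<in> C}"
  let ?\<D> = "insert C ((\<lambda>k. coord_preimage \<Omega> \<Sigma> k {p k}) ` (\<Omega> - {i}))"
  have LP: "simple_closure_space ?P L" using L unfolding product_spaces_def by blast
  have "coord_preimage \<Omega> \<Sigma> k {p k} \<in> L" if k: "k \<in> \<Omega>" for k
    using coord_preimage_closed[OF L S k] S[OF k] PiE_mem[OF p k]
    unfolding simple_closure_space_def by blast
  then have "?\<D> \<subseteq> L" using C by auto
  moreover have "\<A> \<noteq> {} \<Longrightarrow> \<Inter>\<A> \<in> L" if "\<A> \<subseteq> L" for \<A>
    using LP that unfolding simple_closure_space_def by simp
  ultimately have "\<Inter>?\<D> \<in> L" by (meson insert_not_empty)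
  moreover have "\<Inter>?\<D> = replace_coord p ?B i"
  proof
    show "replace_coord p ?B i \<subseteq> \<Inter>?\<D>"
      unfolding replace_coord_def coord_preimage_def using fun_upd_in_PiE[OF p i] by auto
    show "\<Inter>?\<D> \<subseteq> replace_coord p ?B i"
    proof
      fix x assume x: "x \<in> \<Inter>?\<D>"
      then have xC: "x \<in> C" and xk: "\<And>k. k \<in> \<Omega> - {i} \<Longrightarrow> x k = p k"
        unfolding coord_preimage_def by auto
      then have xP: "x \<in> ?P" using LP C unfolding simple_closure_space_def by blast
      have "x = p(i := x i)"
      proof
        fix k show "x k = (p(i := x i)) k"
          using xk[of k] PiE_arb[OF xP, of k] PiE_arb[OF p, of k] by (cases "k \<in> \<Omega>") auto
      qed
      then show "x \<in> replace_coord p ?B i"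
        unfolding replace_coord_def using xC PiE_mem[OF xP i] by auto
    qed
  qed
  ultimately have "replace_coord p ?B i \<in> L" by simp
  moreover have "\<forall>p \<in> ?P. \<forall>\<beta>\<in>\<Omega>. \<forall>B. B \<subseteq> \<Sigma> \<beta> \<longrightarrow> replace_coord p B \<beta> \<in> L \<longrightarrow> B \<in> Ls \<beta>"
    using L unfolding product_spaces_def by simp
  then have "\<forall>B. B \<subseteq> \<Sigma> i \<longrightarrow> replace_coord p B i \<in> L \<longrightarrow> B \<in> Ls i" using p i by simp
  then have "?B \<subseteq> \<Sigma> i \<longrightarrow> replace_coord p ?B i \<in> L \<longrightarrow> ?B \<in> Ls i" by (rule spec)
  moreover have "?B \<subseteq> \<Sigma> i" by auto
  ultimately show ?thesis by simp
qed

section \<open>Weak connectedness forces isometry\<close>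

lemma weakly_connected_two_points:
  assumes "simple_closure_space S L" and "weakly_connected S L"
  shows "two_points S"
proof -
  obtain \<A> where "S = \<Union>\<A>" and A: "\<forall>A\<in>\<A>. two_points A"
    using assms(2) unfolding weakly_connected_def by auto
  moreover have "S \<noteq> {}" using assms(1) unfolding simple_closure_space_def by auto
  ultimately obtain A where "A \<in> \<A>" "A \<subseteq> S" by auto
  then show ?thesis using A unfolding two_points_def by blast
qed

text \<open>
  Each \<open>A\<^sup>\<gamma>\<close> is mapped to a clique, which varies in one coordinate. Two members that share
  two points vary in the same coordinate, since the images of these points are distinct. So along
  a chain from \<open>x\<close> to \<open>y\<close> only one coordinate ever changes.
\<close>

lemma weakly_connected_image_near:
  fixes g :: "'a \<Rightarrow> 'i \<Rightarrow> 'b"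
  assumes wc: "weakly_connected S L" and inj: "inj_on g S"
    and third: "\<And>x y z. x \<in> S \<Longrightarrow> y \<in> S \<Longrightarrow> z \<in> join L {{x}, {y}} \<Longrightarrow> z \<noteq> x \<Longrightarrow> z \<noteq> y
      \<Longrightarrow> near (g x) (g y)"
    and x: "x \<in> S" and y: "y \<in> S"
  shows "near (g x) (g y)"
proof -
  obtain \<A> where \<A>: "\<A> \<subseteq> Pow S"
    and clique: "\<forall>A\<in>\<A>. \<forall>p\<in>A. \<forall>q\<in>A. p \<noteq> q \<longrightarrow> (\<exists>r\<in>join L {{p}, {q}}. r \<noteq> p \<and> r \<noteq> q)"
    and chain: "\<forall>p\<in>S. \<forall>q\<in>S. \<exists>As. As \<noteq> [] \<and> set As \<subseteq> \<A> \<and> p \<in> hd As \<and> q \<in> last As \<and>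
           successively (\<lambda>A B. two_points (A \<inter> B)) As"
    using wc unfolding weakly_connected_def by (elim conjE exE) rule
  define varies_in where "varies_in j A \<longleftrightarrow> (\<forall>x\<in>A. \<forall>y\<in>A. \<forall>k. k \<noteq> j \<longrightarrow> g x k = g y k)" for j A
  have variesD: "g a k = g b k" if "varies_in j A" "a \<in> A" "b \<in> A" "k \<noteq> j" for j A a b k
    using that unfolding varies_in_def by blast
  have par: "\<exists>j. varies_in j A" if A: "A \<in> \<A>" for A
    unfolding varies_in_def
  proof (rule near_family_single_direction)
    show "inj_on g A" using inj A \<A> by (meson inj_on_subset PowD subsetD)
    fix p q assume p: "p \<in> A" and q: "q \<in> A"
    show "near (g p) (g q)"
    proof (cases "p = q")
      case True
      then show ?thesis by (simp add: near_def)
    next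
      case False
      then obtain r where "r \<in> join L {{p}, {q}}" "r \<noteq> p" "r \<noteq> q" using clique A p q by metis
      moreover have "p \<in> S" "q \<in> S" using p q A \<A> by auto
      ultimately show ?thesis using third by metis
    qed
  qed
  have along: "g p k = g q k"
    if "As \<noteq> []" "set As \<subseteq> \<A>" "successively (\<lambda>A B. two_points (A \<inter> B)) As"
      "varies_in j (hd As)" "p \<in> hd As" "q \<in> last As" "k \<noteq> j" for As j p q k
    using that
  proof (induction As arbitrary: p)
    case Nil
    then show ?case by simp
  next
    case (Cons A As)
    have A: "varies_in j A" "p \<in> A" using Cons.prems(4,5) by simp_all
    show ?case
    proof (cases As)
      case Nil
      then show ?thesis using variesD[OF A(1,2) _ Cons.prems(7)] Cons.prems(6) by simp
    next
      case As: (Cons B Bs)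
      have two: "two_points (A \<inter> B)" and succ: "successively (\<lambda>A B. two_points (A \<inter> B)) As"
        using Cons.prems(3) unfolding As by simp_all
      obtain a b where a: "a \<in> A" "a \<in> B" and b: "b \<in> A" "b \<in> B" and ab: "a \<noteq> b"
        using two unfolding two_points_def by blast
      have B: "B \<in> \<A>" using Cons.prems(2) unfolding As by simp
      then have S: "a \<in> S" "b \<in> S" using a b \<A> by auto
      obtain j' where j': "varies_in j' B" using par[OF B] by blast
      have "j' = j"
      proof (rule ccontr)
        assume "j' \<noteq> j"
        then have "g a l = g b l" for l
          using variesD[OF j' a(2) b(2), of l] variesD[OF A(1) a(1) b(1), of l] by metis
        then have "g a = g b" by (rule ext)
        then show False using inj_onD[OF inj _ S] ab by simp
      qed
      then have "g a k = g q k"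
        using Cons.prems(2,6,7) succ j' a(2) unfolding As
        by (intro Cons.IH[unfolded As]) simp_all
      moreover have "g p k = g a k" using variesD[OF A a(1) Cons.prems(7)] .
      ultimately show ?thesis by simp
    qed
  qed
  obtain As where As: "As \<noteq> []" "set As \<subseteq> \<A>" "x \<in> hd As" "y \<in> last As"
    "successively (\<lambda>A B. two_points (A \<inter> B)) As" using chain x y by metis
  then have "hd As \<in> \<A>" by auto
  then obtain j where "varies_in j (hd As)" using par by blast
  then show ?thesis using along[OF As(1,2,5) _ As(3,4)] unfolding near_def by metis
qed

text \<open>
  Continuity gives \<open>\<psi> r \<in> \<psi> p \<squnion> \<psi> q\<close> for \<open>r \<in> p \<squnion> q\<close>. So third points in a factor
  are carried to third points in the product, and \<open>weakly_connected_image_near\<close> applies to \<open>\<psi>\<close>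
  restricted to a line.
\<close>

lemma continuous_injection_preserves_near:
  fixes \<Omega> :: "'i set" and \<Sigma> :: "'i \<Rightarrow> 'a set"
  defines "P \<equiv> (\<Pi>\<^sub>E i\<in>\<Omega>. \<Sigma> i)"
  assumes L: "L \<in> product_spaces \<Omega> \<Sigma> Ls"
    and S: "\<And>i. i \<in> \<Omega> \<Longrightarrow> simple_closure_space (\<Sigma> i) (Ls i)"
    and wc: "\<And>i. i \<in> \<Omega> \<Longrightarrow> weakly_connected (\<Sigma> i) (Ls i)"
    and maps: "\<And>p. p \<in> P \<Longrightarrow> \<psi> p \<in> P" and inj: "inj_on \<psi> P"
    and cont: "\<And>C. C \<in> L \<Longrightarrow> {p \<in> P. \<psi> p \<in> C} \<in> L"
    and p: "p \<in> P" and q: "q \<in> P" and near: "near p q"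
  shows "near (\<psi> p) (\<psi> q)"
proof (cases "p = q")
  case True
  then show ?thesis by (simp add: near_def)
next
  case False
  obtain j where j: "\<And>k. k \<noteq> j \<Longrightarrow> p k = q k" using near unfolding near_def by blast
  have pq: "q = p(j := q j)" using j by auto
  then have "p j \<noteq> q j" using False by (metis fun_upd_triv)
  then have j\<Omega>: "j \<in> \<Omega>" using p q unfolding P_def by (metis PiE_arb)
  have upd: "p(j := x) \<in> P" if "x \<in> \<Sigma> j" for x
    using fun_upd_in_PiE[OF p[unfolded P_def] j\<Omega> that] unfolding P_def .
  have upd_ne: "\<psi> (p(j := x)) \<noteq> \<psi> (p(j := y))" if "x \<in> \<Sigma> j" "y \<in> \<Sigma> j" "x \<noteq> y" for x y
    using inj upd that by (metis fun_upd_same inj_onD)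
  have "near (\<psi> (p(j := p j))) (\<psi> (p(j := q j)))"
  proof (rule weakly_connected_image_near[OF wc[OF j\<Omega>], of "\<lambda>x. \<psi> (p(j := x))"])
    show "inj_on (\<lambda>x. \<psi> (p(j := x))) (\<Sigma> j)" using upd_ne by (meson inj_onI)
    show "p j \<in> \<Sigma> j" "q j \<in> \<Sigma> j" using p q j\<Omega> unfolding P_def by auto
    fix x y z assume x: "x \<in> \<Sigma> j" and y: "y \<in> \<Sigma> j" and z: "z \<in> join (Ls j) {{x}, {y}}" "z \<noteq> x" "z \<noteq> y"
    have z\<Sigma>: "z \<in> \<Sigma> j"
      using z(1) x y join_subset_carrier[OF S[OF j\<Omega>], of "{{x}, {y}}"] by auto
    have "\<psi> (p(j := z)) \<in> C" if C: "C \<in> L" "\<psi> (p(j := x)) \<in> C" "\<psi> (p(j := y)) \<in> C" for C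
    proof -
      let ?B = "{b \<in> \<Sigma> j. p(j := b) \<in> {p \<in> P. \<psi> p \<in> C}}"
      have "?B \<in> Ls j"
        using slice_closed[OF L S p[unfolded P_def] j\<Omega> cont[OF C(1)]] by blast
      moreover have "\<Union>{{x}, {y}} \<subseteq> ?B" using x y C upd by auto
      ultimately have "z \<in> ?B" using z(1) unfolding mem_join_iff by blast
      then show ?thesis by blast
    qed
    then have "\<psi> (p(j := z)) \<in> join L {{\<psi> (p(j := x))}, {\<psi> (p(j := y))}}"
      unfolding mem_join_iff by auto
    then show "near (\<psi> (p(j := x))) (\<psi> (p(j := y)))"
      using third_point_imp_near[OF L S] maps[OF upd] x y z\<Sigma> z(2,3) upd_ne unfolding P_def by metis
  qed
  then show ?thesis using pq by simp
qed

section \<open>The factorization\<close>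

theorem theorem6p7:
  fixes \<Omega> :: "'i set"
    and \<Sigma> :: "'i \<Rightarrow> 'a set"
    and Ls :: "'i \<Rightarrow> 'a set set"
    and L :: "('i \<Rightarrow> 'a) set set"
    and u :: "('i \<Rightarrow> 'a) set \<Rightarrow> ('i \<Rightarrow> 'a) set"
  assumes "finite \<Omega>"
    and "\<And>i. i \<in> \<Omega> \<Longrightarrow> simple_closure_space (\<Sigma> i) (Ls i)"
    and "\<And>i. i \<in> \<Omega> \<Longrightarrow> weakly_connected (\<Sigma> i) (Ls i)"
    and "L \<in> product_spaces \<Omega> \<Sigma> Ls"
    and "cl_arrow L L u"
    and "large \<Omega> \<Sigma> L u"
    and "atoms_to_atoms L L u"
    and "cl_automorphism L u"
  shows "\<exists>f v. bij_betw f \<Omega> \<Omega> \<and>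
           (\<forall>i\<in>\<Omega>. cl_arrow (Ls i) (Ls (f i)) (v i) \<and> atoms_to_atoms (Ls i) (Ls (f i)) (v i)) \<and>
           (\<forall>p \<in> (\<Pi>\<^sub>E i\<in>\<Omega>. \<Sigma> i). \<forall>i\<in>\<Omega>.
              (point_map u p) (f i) = point_map (v i) (p i))"
proof -
  note S = assms(2) and wc = assms(3) and L = assms(4)
  define P where "P = (\<Pi>\<^sub>E i\<in>\<Omega>. \<Sigma> i)"
  define \<phi> where "\<phi> = point_map u"
  define \<psi> where "\<psi> = inv_into P \<phi>"
  have LP: "simple_closure_space P L" using L unfolding product_spaces_def P_def by blast
  note aut = automorphism_point_map[OF LP assms(7,8), folded \<phi>_def]
  have bij: "bij_betw \<phi> P P" by (fact aut(1))
  have \<phi>P: "\<phi> p \<in> P" and \<psi>P: "\<psi> p \<in> P" and \<psi>\<phi>: "\<psi> (\<phi> p) = p" and \<phi>\<psi>: "\<phi> (\<psi> p) = p" if "p \<in> P" for p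
    using that bij_betw_apply[OF bij] bij_betw_apply[OF bij_betw_inv_into[OF bij]]
      bij_betw_inv_into_left[OF bij] bij_betw_inv_into_right[OF bij] unfolding \<psi>_def by auto
  have \<psi>_cont: "{p \<in> P. \<psi> p \<in> C} \<in> L" if C: "C \<in> L" for C
  proof -
    have "C \<subseteq> P" using C LP unfolding simple_closure_space_def by blast
    then have "{p \<in> P. \<psi> p \<in> C} = \<phi> ` C" using \<phi>P \<psi>\<phi> \<phi>\<psi> by (auto 4 3 intro: rev_image_eqI)
    then show ?thesis using aut(2)[OF C] by simp
  qed
  note pres = continuous_injection_preserves_near[OF L S wc, folded P_def]
  have near_\<psi>: "near (\<psi> p) (\<psi> q)" if "p \<in> P" "q \<in> P" "near p q" for p q
    by (rule pres) (use that \<psi>P \<phi>\<psi> \<psi>_cont in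
        \<open>auto intro: inj_on_inverseI[of _ \<phi>]\<close>)
  have near_\<phi>: "near (\<phi> p) (\<phi> q)" if "p \<in> P" "q \<in> P" "near p q" for p q
    by (rule pres) (use that \<phi>P \<psi>\<phi> aut(3) in \<open>auto intro: inj_on_inverseI[of _ \<psi>]\<close>)
  have near_iff: "near (\<phi> p) (\<phi> q) \<longleftrightarrow> near p q" if "p \<in> P" "q \<in> P" for p q
    using near_\<phi>[OF that] near_\<psi>[of "\<phi> p" "\<phi> q"] \<phi>P \<psi>\<phi> that by auto
  have "\<exists>f g. bij_betw f \<Omega> \<Omega> \<and> (\<forall>p\<in>P. \<forall>i\<in>\<Omega>. \<phi> p (f i) = g i (p i))"
    using near_automorphism_is_coordinatewise[of \<Omega> \<Sigma> \<phi>, folded P_def, OF assms(1)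
        weakly_connected_two_points[OF S wc] \<phi>P bij_betw_imp_inj_on[OF bij] near_iff] .
  then obtain f g where f: "bij_betw f \<Omega> \<Omega>"
    and fg': "\<forall>p\<in>P. \<forall>i\<in>\<Omega>. \<phi> p (f i) = g i (p i)"
    by (elim exE conjE) rule
  have fg: "\<phi> p (f i) = g i (p i)" if "p \<in> P" "i \<in> \<Omega>" for p i using fg' that by auto
  obtain base where base: "base \<in> P" using LP unfolding simple_closure_space_def by blast
  have f\<Omega>: "f i \<in> \<Omega>" if "i \<in> \<Omega>" for i using bij_betw_apply[OF f that] .
  have upd: "base(i := x) \<in> P" if "i \<in> \<Omega>" "x \<in> \<Sigma> i" for i x
    using fun_upd_in_PiE[OF base[unfolded P_def] that] unfolding P_def .
  have g: "g i \<in> \<Sigma> i \<rightarrow> \<Sigma> (f i)" if i: "i \<in> \<Omega>" for i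
  proof
    fix x assume x: "x \<in> \<Sigma> i"
    have "\<phi> (base(i := x)) (f i) = g i x" using fg[OF upd[OF i x] i] by simp
    moreover have "\<phi> (base(i := x)) (f i) \<in> \<Sigma> (f i)"
      using PiE_mem[OF \<phi>P[OF upd[OF i x], unfolded P_def] f\<Omega>[OF i]] .
    ultimately show "g i x \<in> \<Sigma> (f i)" by simp
  qed
  have cont: "{x \<in> \<Sigma> i. g i x \<in> C} \<in> Ls i" if i: "i \<in> \<Omega>" and C: "C \<in> Ls (f i)" for i C
  proof -
    let ?D = "{p \<in> P. \<phi> p \<in> coord_preimage \<Omega> \<Sigma> (f i) C}"
    have "?D \<in> L" by (rule aut(3)[OF coord_preimage_closed[OF L S f\<Omega>[OF i] C]])
    then have "{b \<in> \<Sigma> i. base(i := b) \<in> ?D} \<in> Ls i"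
      using slice_closed[OF L S base[unfolded P_def] i] by blast
    moreover have "{b \<in> \<Sigma> i. base(i := b) \<in> ?D} = {x \<in> \<Sigma> i. g i x \<in> C}"
    proof (rule Collect_cong, rule conj_cong[OF refl])
      fix b assume b: "b \<in> \<Sigma> i"
      have "\<phi> (base(i := b)) (f i) = g i b" using fg[OF upd[OF i b] i] by simp
      then show "base(i := b) \<in> ?D \<longleftrightarrow> g i b \<in> C"
        using upd[OF i b] \<phi>P[OF upd[OF i b]] by (simp add: coord_preimage_def P_def)
    qed
    ultimately show ?thesis by simp
  qed
  let ?v = "\<lambda>i A. join (Ls (f i)) {g i ` A}"
  have arrow: "cl_arrow (Ls i) (Ls (f i)) (?v i)" "atoms_to_atoms (Ls i) (Ls (f i)) (?v i)"
    "x \<in> \<Sigma> i \<Longrightarrow> point_map (?v i) x = g i x" if i: "i \<in> \<Omega>" for i x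
    using arrow_of_continuous_point_map[OF S[OF i] S[OF f\<Omega>[OF i]] g[OF i] cont[OF i]] by simp_all
  have "point_map u p (f i) = point_map (?v i) (p i)" if "p \<in> P" "i \<in> \<Omega>" for p i
  proof -
    have "p i \<in> \<Sigma> i" using that unfolding P_def by auto
    then show ?thesis using arrow(3)[OF that(2)] fg[OF that] unfolding \<phi>_def by simp
  qed
  then show ?thesis
    using f arrow(1,2) unfolding P_def by (intro exI[of _ f] exI[of _ ?v]) simp
qed

end
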